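(* Let $\gamma$ be a modulus function. Then the Lebesgue density topology $\tau_d$ is finer than the modulus density topology $\tau_\gamma$, i.e. $\tau_\gamma\subset\tau_d$.
   Context: $|\cdot|$ denotes Lebesgue measure on $\mathbb{R}$, $\mathcal{L}$ the family of Lebesgue measurable subsets of $\mathbb{R}$, and $A^c=\mathbb{R}\setminus A$. A modulus function is a function $\gamma:[0,\infty)\to[0,\infty)$ such that (i) $\gamma(a)=0\Leftrightarrow a=0$; (ii) $\gamma(a+b)\le\gamma(a)+\gamma(b)$ for all $a,b\ge 0$; (iii) $\gamma$ is right-continuous at $0$; (iv) $\gamma$ is increasing (in the weak sense: $a\le b$ implies $\gamma(a)\le\gamma(b)$). For $A\in\mathcal{L}$, $\mathcal{D}_\gamma(A)$ is the set of all $x\in\mathbb{R}$ with $\lim_{\alpha\to 0^+}\frac{\gamma(|(x-\alpha,x+\alpha)\cap A^c|)}{\gamma(2\alpha)}=0$, and $\Phi(A)$ is the set of all $x\in\mathbb{R}$ with $\lim_{\alpha\to 0^+}\frac{|A\cap(x-\alpha,x+\alpha)|}{2\alpha}=1$. The modulus density topology is $\tau_\gamma=\{A\in\mathcal{L}:A\subset\mathcal{D}_\gamma(A)\}$ and the Lebesgue density topology is $\tau_d=\{A\in\mathcal{L}:A\subset\Phi(A)\}$. *)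

theory Defs
  imports "HOL-Analysis.Analysis"
begin

text \<open>A function on \<open>[0,\<infinity>)\<close> is represented by a total function on the reals; only its values at
  nonnegative arguments are constrained, and only those are used below.\<close>

definition modulus_function :: "(real \<Rightarrow> real) \<Rightarrow> bool" where
  "modulus_function \<gamma> \<longleftrightarrow>
     (\<forall>a\<ge>0. \<gamma> a \<ge> 0) \<and>
     (\<forall>a\<ge>0. \<gamma> a = 0 \<longleftrightarrow> a = 0) \<and>
     (\<forall>a\<ge>0. \<forall>b\<ge>0. \<gamma> (a + b) \<le> \<gamma> a + \<gamma> b) \<and>
     continuous (at_right 0) \<gamma> \<and>
     mono_on {0..} \<gamma>"

definition modulus_density_points :: "(real \<Rightarrow> real) \<Rightarrow> real set \<Rightarrow> real set" where
  "modulus_density_points \<gamma> A =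
     {x. ((\<lambda>\<alpha>. \<gamma> (measure lebesgue ({x - \<alpha><..<x + \<alpha>} \<inter> - A)) / \<gamma> (2 * \<alpha>)) \<longlongrightarrow> 0) (at_right 0)}"

definition density_points :: "real set \<Rightarrow> real set" where
  "density_points A =
     {x. ((\<lambda>\<alpha>. measure lebesgue (A \<inter> {x - \<alpha><..<x + \<alpha>}) / (2 * \<alpha>)) \<longlongrightarrow> 1) (at_right 0)}"

text \<open>Both topologies are given by their families of open sets.\<close>

definition modulus_density_topology :: "(real \<Rightarrow> real) \<Rightarrow> real set set" where
  "modulus_density_topology \<gamma> = {A \<in> sets lebesgue. A \<subseteq> modulus_density_points \<gamma> A}"

definition lebesgue_density_topology :: "real set set" where
  "lebesgue_density_topology = {A \<in> sets lebesgue. A \<subseteq> density_points A}"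

end

theory Submission
  imports Defs
begin

text \<open>Subadditivity and monotonicity let a modulus function \<open>\<gamma>\<close> detect ratios. If
  \<open>n * \<gamma> m < \<gamma> s\<close>, then \<open>\<gamma> (n * m) \<le> n * \<gamma> m < \<gamma> s\<close>, and monotonicity forces \<open>n * m < s\<close>. Hence
  \<open>\<gamma> m / \<gamma> s \<longlongrightarrow> 0\<close> implies \<open>m / s \<longlongrightarrow> 0\<close>. With \<open>m\<close> the measure of the part of the interval
  \<open>(x - \<alpha>, x + \<alpha>)\<close> outside \<open>A\<close> and \<open>s = 2 * \<alpha>\<close>, every modulus density point of \<open>A\<close> is one at which
  the complement of \<open>A\<close> has Lebesgue density zero, that is, a Lebesgue density point of \<open>A\<close>.\<close>

lemma modulus_function_of_nat_mult_le:
  assumes "modulus_function \<gamma>" and "a \<ge> 0"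
  shows "\<gamma> (real n * a) \<le> real n * \<gamma> a"
proof (induction n)
  case 0
  have "\<gamma> 0 = 0"
    using assms(1) by (simp add: modulus_function_def)
  then show ?case by simp
next
  case (Suc n)
  have "\<gamma> (real n * a + a) \<le> \<gamma> (real n * a) + \<gamma> a"
    using assms by (simp add: modulus_function_def)
  with Suc.IH show ?case by (simp add: algebra_simps)
qed

lemma modulus_function_pos:
  assumes "modulus_function \<gamma>" and "a > 0"
  shows "\<gamma> a > 0"
proof -
  have "\<gamma> a \<ge> 0" and "\<gamma> a \<noteq> 0"
    using assms by (simp_all add: modulus_function_def)
  then show ?thesis by simp
qed

lemma of_nat_mult_less_if_modulus_function_less:
  assumes \<gamma>: "modulus_function \<gamma>" and "m \<ge> 0" "s \<ge> 0" and less: "real n * \<gamma> m < \<gamma> s"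
  shows "real n * m < s"
proof (rule ccontr)
  assume "\<not> real n * m < s"
  then have "\<gamma> s \<le> \<gamma> (real n * m)"
    using \<gamma> \<open>m \<ge> 0\<close> \<open>s \<ge> 0\<close> by (auto simp: modulus_function_def mono_on_def)
  also have "\<dots> \<le> real n * \<gamma> m"
    by (rule modulus_function_of_nat_mult_le[OF \<gamma> \<open>m \<ge> 0\<close>])
  finally show False using less by simp
qed

lemma modulus_function_ratio_tendsto_0_imp:
  assumes \<gamma>: "modulus_function \<gamma>"
    and lim: "((\<lambda>t. \<gamma> (m t) / \<gamma> (s t)) \<longlongrightarrow> 0) F"
    and m: "\<forall>\<^sub>F t in F. m t \<ge> 0" and s: "\<forall>\<^sub>F t in F. s t > 0"
  shows "((\<lambda>t. m t / s t) \<longlongrightarrow> 0) F"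
proof (rule tendstoI)
  fix e :: real
  assume "e > 0"
  then obtain n :: nat where n: "n > 0" "1 / real n < e"
    using ex_inverse_of_nat_less by (auto simp: inverse_eq_divide)
  have "\<forall>\<^sub>F t in F. \<gamma> (m t) / \<gamma> (s t) < 1 / real n"
    using order_tendstoD(2)[OF lim] n by simp
  then show "\<forall>\<^sub>F t in F. dist (m t / s t) 0 < e"
    using m s
  proof eventually_elim
    case (elim t)
    have "real n * \<gamma> (m t) < \<gamma> (s t)"
      using elim n modulus_function_pos[OF \<gamma> elim(3)] by (simp add: field_simps)
    then have "real n * m t < s t"
      using of_nat_mult_less_if_modulus_function_less[OF \<gamma>] elim by simp
    then have "m t / s t < 1 / real n"
      using elim n by (simp add: field_simps)
    with n elim show ?case by simp
  qed
qed

lemma measure_Int_interval_ratio_eq: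
  fixes x \<alpha> :: real
  assumes A: "A \<in> sets lebesgue" and "\<alpha> > 0"
  shows "measure lebesgue (A \<inter> {x - \<alpha><..<x + \<alpha>}) / (2 * \<alpha>) =
    1 - measure lebesgue ({x - \<alpha><..<x + \<alpha>} \<inter> - A) / (2 * \<alpha>)"
proof -
  let ?I = "{x - \<alpha><..<x + \<alpha>}"
  have "?I - ?I \<inter> A = ?I \<inter> - A"
    by blast
  moreover have "?I \<in> lmeasurable"
    by simp
  then have "measure lebesgue (?I - ?I \<inter> A) = measure lebesgue ?I - measure lebesgue (?I \<inter> A)"
    using A by (intro measurable_measure_Diff) auto
  moreover have "measure lebesgue ?I = 2 * \<alpha>"
    using \<open>\<alpha> > 0\<close> by simp
  ultimately have "measure lebesgue (A \<inter> ?I) = 2 * \<alpha> - measure lebesgue (?I \<inter> - A)"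
    by (simp add: Int_commute)
  then show ?thesis using \<open>\<alpha> > 0\<close> by (simp add: diff_divide_distrib)
qed

lemma modulus_density_points_subset_density_points:
  assumes \<gamma>: "modulus_function \<gamma>" and A: "A \<in> sets lebesgue"
  shows "modulus_density_points \<gamma> A \<subseteq> density_points A"
proof
  fix x
  assume "x \<in> modulus_density_points \<gamma> A"
  then have lim: "((\<lambda>\<alpha>. \<gamma> (measure lebesgue ({x - \<alpha><..<x + \<alpha>} \<inter> - A)) / \<gamma> (2 * \<alpha>)) \<longlongrightarrow> 0) (at_right 0)"
    by (simp add: modulus_density_points_def)
  have pos: "\<forall>\<^sub>F \<alpha> :: real in at_right 0. \<alpha> > 0"
    by (rule eventually_at_right_less)
  have "((\<lambda>\<alpha>. measure lebesgue ({x - \<alpha><..<x + \<alpha>} \<inter> - A) / (2 * \<alpha>)) \<longlongrightarrow> 0) (at_right 0)"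
    by (rule modulus_function_ratio_tendsto_0_imp[OF \<gamma> lim]) (use pos in simp_all)
  from tendsto_diff[OF tendsto_const[of 1] this]
  have "((\<lambda>\<alpha>. 1 - measure lebesgue ({x - \<alpha><..<x + \<alpha>} \<inter> - A) / (2 * \<alpha>)) \<longlongrightarrow> 1) (at_right 0)"
    by simp
  then have "((\<lambda>\<alpha>. measure lebesgue (A \<inter> {x - \<alpha><..<x + \<alpha>}) / (2 * \<alpha>)) \<longlongrightarrow> 1) (at_right 0)"
    by (rule Lim_transform_eventually)
      (use pos in eventually_elim, simp only: measure_Int_interval_ratio_eq[OF A])
  then show "x \<in> density_points A"
    by (simp add: density_points_def)
qed

theorem theorem9:
  fixes \<gamma> :: "real \<Rightarrow> real"
  assumes "modulus_function \<gamma>"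
  shows "modulus_density_topology \<gamma> \<subseteq> lebesgue_density_topology"
  using modulus_density_points_subset_density_points[OF assms]
  by (auto simp: modulus_density_topology_def lebesgue_density_topology_def)

end
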